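(* There exists $(\boldsymbol\phi^*,\boldsymbol\psi^* )\in\mathcal A_C$ such that $$J_\epsilon(\boldsymbol\phi^*,\boldsymbol\psi^* )=\sup_{(\boldsymbol\phi,\boldsymbol\psi)\in\mathcal A_C}J_\epsilon(\boldsymbol\phi,\boldsymbol\psi).$$ More precisely, every maximizing sequence can be modified without decreasing its values so that the modified sequence has a uniformly convergent subsequence: for every sequence $(\boldsymbol\phi_n,\boldsymbol\psi_n)_{n}$ in $\mathcal A_C$ with $J_\epsilon(\boldsymbol\phi_n,\boldsymbol\psi_n)\to\sup_{\mathcal A_C}J_\epsilon$ there is a sequence $(\widehat{\boldsymbol\phi}_n,\widehat{\boldsymbol\psi}_n)_n$ in $\mathcal A_C$ with $J_\epsilon(\widehat{\boldsymbol\phi}_n,\widehat{\boldsymbol\psi}_n)\ge J_\epsilon(\boldsymbol\phi_n,\boldsymbol\psi_n)$ for every $n$, and a subsequence along which, for each $i=1,\dots,p$, $\widehat\phi_{i,n}$ converges uniformly on $X_i$ and $\widehat\psi_{i,n}$ converges uniformly on $Y$.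
   Context: Setting. Let $p\ge 2$ and $\epsilon>0$. Let $X_1,\dots,X_p$ and $Y$ be compact metric spaces; $\mathcal P(Z)$ denotes the Borel probability measures on $Z$ and $C(Z)$ the real-valued continuous functions on $Z$. For each $i$, let $\nu_i\in\mathcal P(X_i)$, $c_i\in C(X_i\times Y)$, and $\lambda_i>0$ with $\sum_{i=1}^p\lambda_i=1$. Fix $\eta\in\mathcal P(Y)$. Standing assumption: $\operatorname{spt}\nu_i=X_i$ for all $i$ and $\operatorname{spt}\eta=Y$. Set $\xi_i:=\nu_i\otimes\eta$ (product measure). $\mathcal A_C$ is the set of pairs $(\boldsymbol\phi,\boldsymbol\psi)$ with $\boldsymbol\phi=(\phi_1,\dots,\phi_p)$, $\boldsymbol\psi=(\psi_1,\dots,\psi_p)$, $\phi_i\in C(X_i)$, $\psi_i\in C(Y)$ and $\sum_{i=1}^p\lambda_i\psi_i=0$ on $Y$. The dual functional is $$J_\epsilon(\boldsymbol\phi,\boldsymbol\psi):=\sum_{i=1}^p\lambda_i\left[\int_{X_i}\phi_i\,d\nu_i-\epsilon\int_{X_i\times Y}\exp\left(\frac{\phi_i(x)+\psi_i(y)-c_i(x,y)}{\epsilon}\right)d\xi_i(x,y)\right].$$ *)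

theory Defs
  imports "HOL-Probability.Probability"
begin

text \<open>
  The spaces \<open>X\<^sub>1, \<dots>, X\<^sub>p\<close> are compact subsets \<open>X i\<close> (\<open>i \<in> {1..p}\<close>) of one metric space
  \<open>'a\<close>. This loses no generality: any finite family of compact metric spaces embeds
  isometrically, as pairwise disjoint subsets, into its disjoint union, where points of different
  summands are put at one fixed positive distance, not smaller than the (finite) diameters. A function on
  \<open>X i\<close> is given by any extension to the whole type; only its values on \<open>X i\<close> are ever used, and
  components with an index outside \<open>{1..p}\<close> are irrelevant.
\<close>

definition borel_probs :: "'a::topological_space set \<Rightarrow> 'a measure set" where
  "borel_probs Z = {\<mu>. prob_space \<mu> \<and> sets \<mu> = sets (restrict_space borel Z)}"

definition spt :: "'a::topological_space measure \<Rightarrow> 'a set" where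
  "spt \<mu> = {x \<in> space \<mu>. \<forall>U. open U \<and> x \<in> U \<longrightarrow> emeasure \<mu> (U \<inter> space \<mu>) > 0}"

definition admissible ::
  "nat \<Rightarrow> (nat \<Rightarrow> 'a::topological_space set) \<Rightarrow> 'b::topological_space set \<Rightarrow> (nat \<Rightarrow> real) \<Rightarrow>
    ((nat \<Rightarrow> 'a \<Rightarrow> real) \<times> (nat \<Rightarrow> 'b \<Rightarrow> real)) set" where
  "admissible p X Y l = {(\<phi>, \<psi>).
     (\<forall>i\<in>{1..p}. continuous_on (X i) (\<phi> i) \<and> continuous_on Y (\<psi> i)) \<and>
     (\<forall>y\<in>Y. (\<Sum>i=1..p. l i * \<psi> i y) = 0)}"

definition dual_J ::
  "nat \<Rightarrow> real \<Rightarrow> (nat \<Rightarrow> real) \<Rightarrow> (nat \<Rightarrow> 'a measure) \<Rightarrow> 'b measure \<Rightarrow> (nat \<Rightarrow> 'a \<times> 'b \<Rightarrow> real) \<Rightarrow>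
    (nat \<Rightarrow> 'a \<Rightarrow> real) \<times> (nat \<Rightarrow> 'b \<Rightarrow> real) \<Rightarrow> real" where
  "dual_J p \<epsilon> l \<nu> \<eta> c = (\<lambda>(\<phi>, \<psi>).
     \<Sum>i=1..p. l i * ((\<integral>x. \<phi> i x \<partial>\<nu> i)
       - \<epsilon> * (\<integral>(x, y). exp ((\<phi> i x + \<psi> i y - c i (x, y)) / \<epsilon>) \<partial>(\<nu> i \<Otimes>\<^sub>M \<eta>))))"

text \<open>
  The supremum of the dual functional is taken in \<open>ereal\<close>, because the supremum of an unbounded
  set of reals is unspecified; that it is finite is part of what has to be proved.
\<close>

definition dual_sup ::
  "nat \<Rightarrow> real \<Rightarrow> (nat \<Rightarrow> 'a::topological_space set) \<Rightarrow> 'b::topological_space set \<Rightarrow>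
    (nat \<Rightarrow> real) \<Rightarrow> (nat \<Rightarrow> 'a measure) \<Rightarrow> 'b measure \<Rightarrow> (nat \<Rightarrow> 'a \<times> 'b \<Rightarrow> real) \<Rightarrow> ereal" where
  "dual_sup p \<epsilon> X Y l \<nu> \<eta> c = (SUP q \<in> admissible p X Y l. ereal (dual_J p \<epsilon> l \<nu> \<eta> c q))"

end

theory Submission imports Defs "HOL-Complex_Analysis.Great_Picard"
begin

text \<open>
  Alternate maximisation: for fixed \<open>\<phi>\<close> the optimal admissible \<open>\<psi>\<close>, and then for fixed \<open>\<psi>\<close> the
  optimal \<open>\<phi>\<close>, are explicit in terms of \<open>u \<mapsto> \<epsilon> log \<integral> exp (u / \<epsilon>)\<close>, which is
  nonexpansive in the supremum norm. Hence the new potentials inherit the modulus of continuity of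
  the costs, whatever the old ones were. Constants \<open>a\<^sub>i\<close> with \<open>\<Sum> l\<^sub>i a\<^sub>i = 0\<close> can be moved
  between \<open>\<psi>\<^sub>i\<close> and \<open>\<phi>\<^sub>i\<close> without changing the functional, so all \<open>\<psi>\<^sub>i\<close> may be made to vanish at one
  base point; this bounds everything by a multiple of the supremum of the costs, and
  Arzela--Ascoli applies. The functional is continuous under bounded uniform convergence, which
  gives the maximiser.
\<close>

section \<open>Extraction of subsequences and the Arzela-Ascoli theorem on a compact metric
  space\<close>

lemma uniformly_convergent_on_subseq:
  assumes "uniformly_convergent_on S f" and "strict_mono (k :: nat \<Rightarrow> nat)"
  shows "uniformly_convergent_on S (\<lambda>n. f (k n))"
proof -
  obtain g where "uniform_limit S f g sequentially"
    using assms(1) by (auto simp: uniformly_convergent_on_def)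
  then have "uniform_limit S (\<lambda>n. f (k n)) g sequentially"
    by (rule filterlim_compose[OF _ filterlim_subseq[OF assms(2)]])
  then show ?thesis
    by (auto simp: uniformly_convergent_on_def)
qed

text \<open>Refine once per index. Since \<open>P i\<close> passes to further subsequences, what was
  achieved for earlier indices survives the later refinements.\<close>

lemma finite_common_subseq:
  fixes P :: "'i \<Rightarrow> (nat \<Rightarrow> nat) \<Rightarrow> bool"
  assumes "finite I"
    and ex: "\<And>i (r :: nat \<Rightarrow> nat). i \<in> I \<Longrightarrow> strict_mono r \<Longrightarrow>
      \<exists>k :: nat \<Rightarrow> nat. strict_mono k \<and> P i (r \<circ> k)"
    and sub: "\<And>i r (k :: nat \<Rightarrow> nat). i \<in> I \<Longrightarrow> P i r \<Longrightarrow> strict_mono k \<Longrightarrow> P i (r \<circ> k)"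
  shows "\<exists>r. strict_mono r \<and> (\<forall>i\<in>I. P i r)"
  using assms
proof (induction I rule: finite_induct)
  case empty
  show ?case by (auto intro: strict_mono_id)
next
  case (insert j I)
  have "\<exists>r. strict_mono r \<and> (\<forall>i\<in>I. P i r)"
    by (rule insert.IH[OF insert.prems(1)[OF insertI2] insert.prems(2)[OF insertI2]])
  then obtain r where r: "strict_mono r" "\<forall>i\<in>I. P i r"
    by blast
  obtain k where k: "strict_mono k" "P j (r \<circ> k)"
    using insert.prems(1)[OF insertI1 r(1)] by blast
  then have "\<forall>i\<in>insert j I. P i (r \<circ> k)"
    using insert.prems(2)[OF insertI2 bspec[OF r(2)] k(1)] by blast
  then show ?case
    using strict_mono_o[OF r(1) k(1)] by blast
qed

text \<open>By total boundedness there is a finite net of radius \<open>1 / (n + 1)\<close> for each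
  \<open>n\<close>; the union of these nets is countable and dense.\<close>

lemma compact_countable_dense_subset:
  fixes S :: "'a::metric_space set"
  assumes "compact S"
  obtains D where "countable D" "D \<subseteq> S" "\<And>x e. x \<in> S \<Longrightarrow> e > 0 \<Longrightarrow> \<exists>a\<in>D. dist a x < e"
proof -
  have "\<forall>n. \<exists>A. finite A \<and> A \<subseteq> S \<and> S \<subseteq> (\<Union>a\<in>A. ball a (inverse (real (Suc n))))"
    using compact_imp_seq_compact[OF assms, THEN seq_compact_imp_totally_bounded]
    by simp
  then obtain A where A: "\<And>n. finite (A n)" "\<And>n. A n \<subseteq> S"
      "\<And>n. S \<subseteq> (\<Union>a\<in>A n. ball a (inverse (real (Suc n))))"
    by metis
  show thesis
  proof
    show "countable (\<Union>n. A n)"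
      using A(1) by (intro countable_UN) (auto intro: countable_finite)
    show "(\<Union>n. A n) \<subseteq> S"
      using A(2) by blast
    fix x and e :: real assume "x \<in> S" "e > 0"
    obtain n where "inverse (real (Suc n)) < e"
      using reals_Archimedean[OF \<open>e > 0\<close>] by blast
    moreover obtain a where "a \<in> A n" "dist a x < inverse (real (Suc n))"
      using A(3)[of n] \<open>x \<in> S\<close> by auto
    ultimately show "\<exists>a\<in>\<Union>n. A n. dist a x < e"
      by (intro bexI[of _ a]) auto
  qed
qed

text \<open>A diagonal subsequence converges at every point of a countable dense set. Equicontinuity
  and a finite subcover by balls around points of that set turn this into a uniform Cauchy
  condition.\<close>

lemma Arzela_Ascoli_metric:
  fixes F :: "nat \<Rightarrow> 'a::metric_space \<Rightarrow> real"
  assumes "compact S"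
    and bdd: "\<And>n x. x \<in> S \<Longrightarrow> \<bar>F n x\<bar> \<le> B"
    and equi: "\<And>e. e > 0 \<Longrightarrow> \<exists>d>0. \<forall>n. \<forall>x\<in>S. \<forall>x'\<in>S. dist x x' < d \<longrightarrow> \<bar>F n x - F n x'\<bar> \<le> e"
  obtains k where "strict_mono (k :: nat \<Rightarrow> nat)" "uniformly_convergent_on S (\<lambda>n. F (k n))"
proof -
  obtain D where D: "countable D" "D \<subseteq> S"
    and dense: "\<And>x e. x \<in> S \<Longrightarrow> e > 0 \<Longrightarrow> \<exists>a\<in>D. dist a x < e"
    using compact_countable_dense_subset[OF \<open>compact S\<close>] by metis
  obtain k where k: "strict_mono (k :: nat \<Rightarrow> nat)"
    and conv: "\<And>x. x \<in> D \<Longrightarrow> \<exists>l. (\<lambda>n. F (k n) x) \<longlonglongrightarrow> l"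
    using function_convergent_subsequence[OF D(1), of F B] bdd D(2) by (metis real_norm_def subsetD)
  have "uniformly_Cauchy_on S (\<lambda>n. F (k n))"
    unfolding uniformly_Cauchy_on_def
  proof (intro allI impI)
    fix e :: real assume "e > 0"
    \<comment> \<open>Passing from \<open>x\<close> to a nearby centre, changing the index there,
      and passing back costs \<open>e / 4\<close> each. The total \<open>3 * e / 4\<close> is
      strictly below \<open>e\<close>, although the first and last bounds are not strict.\<close>
    then obtain d where "d > 0"
      and d: "\<And>n x x'. x \<in> S \<Longrightarrow> x' \<in> S \<Longrightarrow> dist x x' < d \<Longrightarrow> \<bar>F n x - F n x'\<bar> \<le> e / 4"
      using equi[of "e / 4"] by auto
    have "S \<subseteq> (\<Union>a\<in>D. ball a d)"
      using dense \<open>d > 0\<close> by fastforce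
    then obtain A where A: "A \<subseteq> D" "finite A" "S \<subseteq> (\<Union>a\<in>A. ball a d)"
      using compactE_image[OF \<open>compact S\<close>, of D "\<lambda>a. ball a d"] by auto
    have "\<forall>\<^sub>F N in sequentially. \<forall>m\<ge>N. \<forall>n\<ge>N. \<bar>F (k m) a - F (k n) a\<bar> < e / 4" if "a \<in> D" for a
    proof -
      have "Cauchy (\<lambda>n. F (k n) a)"
        using conv[OF that] LIMSEQ_imp_Cauchy by blast
      from metric_CauchyD[OF this, of "e / 4"] \<open>e > 0\<close>
      obtain N where "\<forall>m\<ge>N. \<forall>n\<ge>N. \<bar>F (k m) a - F (k n) a\<bar> < e / 4"
        by (auto simp: dist_real_def)
      then show ?thesis
        by (intro eventually_sequentiallyI[of N]) auto
    qed
    then have "\<forall>\<^sub>F N in sequentially. \<forall>a\<in>A. \<forall>m\<ge>N. \<forall>n\<ge>N. \<bar>F (k m) a - F (k n) a\<bar> < e / 4"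
      using A by (intro eventually_ball_finite) auto
    then obtain N where N: "\<And>a m n. a \<in> A \<Longrightarrow> m \<ge> N \<Longrightarrow> n \<ge> N \<Longrightarrow> \<bar>F (k m) a - F (k n) a\<bar> < e / 4"
      unfolding eventually_sequentially by blast
    show "\<exists>M. \<forall>x\<in>S. \<forall>m\<ge>M. \<forall>n\<ge>M. dist (F (k m) x) (F (k n) x) < e"
    proof (intro exI[of _ N] ballI allI impI)
      fix x m n assume "x \<in> S" "N \<le> m" "N \<le> n"
      then obtain a where a: "a \<in> A" "dist x a < d"
        using A(3) by (auto simp: dist_commute)
      then have "a \<in> S"
        using A D by blast
      show "dist (F (k m) x) (F (k n) x) < e"
        using d[OF \<open>x \<in> S\<close> \<open>a \<in> S\<close> a(2), of "k m"] d[OF \<open>x \<in> S\<close> \<open>a \<in> S\<close> a(2), of "k n"]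
          N[OF a(1) \<open>N \<le> m\<close> \<open>N \<le> n\<close>] \<open>e > 0\<close>
        unfolding dist_real_def by linarith
    qed
  qed
  then show thesis
    using that k Cauchy_uniformly_convergent by blast
qed

section \<open>Measurability and integrability of continuous functions on compact sets and
  rectangles\<close>

lemma borel_probsD:
  assumes "\<mu> \<in> borel_probs Z"
  shows "prob_space \<mu>" "sets \<mu> = sets (restrict_space borel Z)" "space \<mu> = Z"
  using assms sets_eq_imp_space_eq[of \<mu> "restrict_space borel Z"]
  by (auto simp: borel_probs_def space_restrict_space)

lemma continuous_on_compact_bdd:
  fixes f :: "'a::topological_space \<Rightarrow> real"
  assumes "compact S" "continuous_on S f"
  obtains B where "\<And>x. x \<in> S \<Longrightarrow> \<bar>f x\<bar> \<le> B"
  using compact_imp_bounded[OF compact_continuous_image[OF assms(2,1)]]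
  by (auto simp: bounded_iff)

lemma integrable_continuous_compact:
  fixes f :: "'a::topological_space \<Rightarrow> real"
  assumes \<mu>: "\<mu> \<in> borel_probs Z" and "compact Z" "continuous_on Z f"
  shows "integrable \<mu> f"
proof -
  interpret prob_space \<mu> by (rule borel_probsD[OF \<mu>])
  obtain B where "\<And>x. x \<in> Z \<Longrightarrow> \<bar>f x\<bar> \<le> B"
    using continuous_on_compact_bdd[OF assms(2,3)] by blast
  moreover have "f \<in> borel_measurable \<mu>"
    using borel_measurable_continuous_on_restrict[OF assms(3)] 
    by (simp add: measurable_cong_sets[OF borel_probsD(2)[OF \<mu>] refl])
  ultimately show ?thesis
    by (intro integrable_const_bound[of _ B]) (auto simp: borel_probsD(3)[OF \<mu>])
qed

text \<open>The types need not be second countable, so the Borel sets of the product type may exceed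
  the product of the Borel algebras.  On a compact rectangle the superlevel sets of a continuous
  function are still countable unions of compact sets, each caught between finitely many open
  rectangles and the superlevel set.\<close>

lemma borel_measurable_pair_continuous:
  fixes f :: "'a::metric_space \<times> 'b::metric_space \<Rightarrow> real"
  assumes M: "M \<in> borel_probs X" and N: "N \<in> borel_probs Y"
    and "compact X" "compact Y" and f: "continuous_on (X \<times> Y) f"
  shows "f \<in> borel_measurable (M \<Otimes>\<^sub>M N)"
proof (rule borel_measurableI_greater)
  fix t :: real
  define U where "U = {z \<in> X \<times> Y. t < f z}"
  define \<R> where "\<R> = {A \<times> B |A B. open A \<and> open B \<and> A \<times> B \<inter> (X \<times> Y) \<subseteq> U}"
  define K where "K n = {z \<in> X \<times> Y. t + inverse (real (Suc n)) \<le> f z}" for n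
  have cover: "U \<subseteq> \<Union>\<R>"
  proof
    fix z assume "z \<in> U"
    have "f -` {t<..} \<inter> (X \<times> Y) = U"
      by (auto simp: U_def)
    then obtain V where V: "open V" "V \<inter> (X \<times> Y) = U"
      using continuous_on_open_invariant[THEN iffD1, OF f, rule_format, of "{t<..}"] by auto
    then have "z \<in> V"
      using \<open>z \<in> U\<close> by blast
    then obtain A B where "open A" "open B" "z \<in> A \<times> B" "A \<times> B \<subseteq> V"
      by (rule open_prod_elim[OF V(1)])
    then have "A \<times> B \<in> \<R>"
      unfolding \<R>_def V(2)[symmetric] by blast
    then show "z \<in> \<Union>\<R>"
      using \<open>z \<in> A \<times> B\<close> by blast
  qed
  have KU: "U = (\<Union>n. K n)"
  proof (intro equalityI subsetI)
    fix z assume z: "z \<in> U"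
    then obtain n where "inverse (real (Suc n)) < f z - t"
      using reals_Archimedean[of "f z - t"] by (auto simp: U_def)
    then have "z \<in> K n"
      using z by (auto simp: U_def K_def)
    then show "z \<in> (\<Union>n. K n)" by blast
  next
    fix z assume "z \<in> (\<Union>n. K n)"
    then obtain n where "z \<in> X \<times> Y" "t + inverse (real (Suc n)) \<le> f z"
      by (auto simp: K_def)
    moreover have "inverse (real (Suc n)) > 0" by simp
    ultimately have "t < f z" by linarith
    then show "z \<in> U" using \<open>z \<in> X \<times> Y\<close> by (simp add: U_def)
  qed
  have "compact (K n)" for n
  proof -
    have "closed (f -` {t + inverse (real (Suc n))..} \<inter> (X \<times> Y))"
      using continuous_on_closed_vimage[of "X \<times> Y" f] f \<open>compact X\<close> \<open>compact Y\<close>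
      by (simp add: compact_imp_closed compact_Times)
    then have "compact (X \<times> Y \<inter> (f -` {t + inverse (real (Suc n))..} \<inter> (X \<times> Y)))"
      using \<open>compact X\<close> \<open>compact Y\<close> by (intro compact_Int_closed compact_Times)
    also have "X \<times> Y \<inter> (f -` {t + inverse (real (Suc n))..} \<inter> (X \<times> Y)) = K n"
      by (auto simp: K_def)
    finally show ?thesis .
  qed
  moreover have "K n \<subseteq> \<Union>\<R>" for n
    using cover KU by blast
  moreover have "open R" if "R \<in> \<R>" for R
    using that by (auto simp: \<R>_def intro: open_Times)
  ultimately have "\<exists>F\<subseteq>\<R>. finite F \<and> K n \<subseteq> \<Union>F" for n
    by (metis compactE)
  then obtain F where F: "\<And>n. F n \<subseteq> \<R>" "\<And>n. finite (F n)" "\<And>n. K n \<subseteq> \<Union>(F n)"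
    by metis
  have "U = (\<Union>n. \<Union>R\<in>F n. R \<inter> (X \<times> Y))"
  proof (intro equalityI subsetI)
    fix z assume "z \<in> U"
    then obtain n R where "R \<in> F n" "z \<in> R"
      using F(3) KU by blast
    moreover have "z \<in> X \<times> Y"
      using \<open>z \<in> U\<close> by (simp add: U_def)
    ultimately show "z \<in> (\<Union>n. \<Union>R\<in>F n. R \<inter> (X \<times> Y))"
      by blast
  next
    fix z assume "z \<in> (\<Union>n. \<Union>R\<in>F n. R \<inter> (X \<times> Y))"
    then obtain R where "R \<in> \<R>" "z \<in> R \<inter> (X \<times> Y)"
      using F(1) by blast
    then show "z \<in> U"
      unfolding \<R>_def by blast
  qed
  moreover have "R \<inter> (X \<times> Y) \<in> sets (M \<Otimes>\<^sub>M N)" if R_in: "R \<in> \<R>" for R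
  proof -
    obtain A B where R: "R = A \<times> B" "open A" "open B"
      using R_in unfolding \<R>_def by blast
    have "A \<inter> X \<in> sets M"
      unfolding borel_probsD(2)[OF M] sets_restrict_space using R(2)
      by (intro image_eqI[of _ _ A]) auto
    moreover have "B \<inter> Y \<in> sets N"
      unfolding borel_probsD(2)[OF N] sets_restrict_space using R(3)
      by (intro image_eqI[of _ _ B]) auto
    ultimately show ?thesis
      unfolding R Times_Int_Times by (rule pair_measureI)
  qed
  then have "(\<Union>n. \<Union>R\<in>F n. R \<inter> (X \<times> Y)) \<in> sets (M \<Otimes>\<^sub>M N)"
    using F(1,2) by (intro sets.countable_UN sets.finite_UN image_subsetI) blast+
  moreover have "{z \<in> space (M \<Otimes>\<^sub>M N). t < f z} = U"
    using borel_probsD(3)[OF M] borel_probsD(3)[OF N] by (simp add: space_pair_measure U_def)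
  ultimately show "{z \<in> space (M \<Otimes>\<^sub>M N). t < f z} \<in> sets (M \<Otimes>\<^sub>M N)"
    by simp
qed

lemma integrable_pair_continuous:
  fixes f :: "'a::metric_space \<times> 'b::metric_space \<Rightarrow> real"
  assumes M: "M \<in> borel_probs X" and N: "N \<in> borel_probs Y"
    and "compact X" "compact Y" and f: "continuous_on (X \<times> Y) f"
  shows "integrable (M \<Otimes>\<^sub>M N) f"
proof -
  interpret M: prob_space M by (rule borel_probsD[OF M])
  interpret N: prob_space N by (rule borel_probsD[OF N])
  interpret pair_prob_space M N ..
  obtain B where "\<And>x. x \<in> X \<times> Y \<Longrightarrow> \<bar>f x\<bar> \<le> B"
    using continuous_on_compact_bdd[OF compact_Times[OF assms(3,4)] f] by blast
  then show ?thesis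
    using borel_measurable_pair_continuous[OF assms]
    by (intro integrable_const_bound[of _ B])
      (auto simp: space_pair_measure borel_probsD(3)[OF M] borel_probsD(3)[OF N])
qed

section \<open>The logarithm of an exponential integral as a soft maximum\<close>

text \<open>This is the soft maximum of \<open>u\<close> at temperature \<open>\<epsilon>\<close>.
  Like a maximum it is monotone and commutes with adding constants.\<close>

definition log_int_exp :: "real \<Rightarrow> 'a measure \<Rightarrow> ('a \<Rightarrow> real) \<Rightarrow> real" where
  "log_int_exp \<epsilon> \<mu> u = \<epsilon> * ln (\<integral>x. exp (u x / \<epsilon>) \<partial>\<mu>)"

text \<open>A continuous \<open>u\<close> is bounded below on the compact set, so the integrand
  stays above a positive constant and \<open>\<mu>\<close> has mass one. Positivity is what lets
  \<open>exp\<close> undo \<open>ln\<close> in \<open>log_int_exp\<close>.\<close>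

lemma integral_exp_pos:
  fixes u :: "'a::topological_space \<Rightarrow> real"
  assumes \<mu>: "\<mu> \<in> borel_probs Z" and "compact Z" "continuous_on Z u"
  shows "(\<integral>x. exp (u x) \<partial>\<mu>) > 0"
proof -
  interpret prob_space \<mu> by (rule borel_probsD[OF \<mu>])
  obtain B where B: "\<And>x. x \<in> Z \<Longrightarrow> \<bar>u x\<bar> \<le> B"
    using continuous_on_compact_bdd[OF assms(2,3)] by blast
  have "integrable \<mu> (\<lambda>x. exp (u x))"
    using assms by (intro integrable_continuous_compact[OF \<mu>] continuous_intros)
  moreover have "exp (- B) \<le> exp (u x)" if "x \<in> space \<mu>" for x
    using B[of x] that borel_probsD(3)[OF \<mu>] by simp
  ultimately have "exp (- B) \<le> (\<integral>x. exp (u x) \<partial>\<mu>)"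
    by (intro integral_ge_const) auto
  then show ?thesis
    by (rule less_le_trans[OF exp_gt_zero])
qed

lemma exp_log_int_exp:
  fixes u :: "'a::topological_space \<Rightarrow> real"
  assumes "\<mu> \<in> borel_probs Z" "compact Z" "continuous_on Z u" "\<epsilon> > 0"
  shows "exp (log_int_exp \<epsilon> \<mu> u / \<epsilon>) = (\<integral>x. exp (u x / \<epsilon>) \<partial>\<mu>)"
proof -
  have "continuous_on Z (\<lambda>x. u x / \<epsilon>)"
    using assms by (intro continuous_intros) auto
  then show ?thesis
    using integral_exp_pos[OF assms(1,2)] \<open>\<epsilon> > 0\<close> by (simp add: log_int_exp_def)
qed

text \<open>Monotonicity and the rule for added constants in one statement: adding
  \<open>\<delta>\<close> to \<open>v\<close> multiplies the exponential integral by
  \<open>exp (\<delta> / \<epsilon>)\<close>.\<close>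

lemma log_int_exp_mono:
  fixes u v :: "'a::topological_space \<Rightarrow> real"
  assumes \<mu>: "\<mu> \<in> borel_probs Z" and Z: "compact Z"
    and u: "continuous_on Z u" and v: "continuous_on Z v" and "\<epsilon> > 0"
    and le: "\<And>x. x \<in> Z \<Longrightarrow> u x \<le> v x + \<delta>"
  shows "log_int_exp \<epsilon> \<mu> u \<le> log_int_exp \<epsilon> \<mu> v + \<delta>"
proof -
  have "(\<integral>x. exp (u x / \<epsilon>) \<partial>\<mu>) \<le> (\<integral>x. exp (v x / \<epsilon>) * exp (\<delta> / \<epsilon>) \<partial>\<mu>)"
  proof (rule integral_mono)
    fix x assume "x \<in> space \<mu>"
    then have "u x / \<epsilon> \<le> v x / \<epsilon> + \<delta> / \<epsilon>"
      using le \<open>\<epsilon> > 0\<close> borel_probsD(3)[OF \<mu>] 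
      by (simp add: add_divide_distrib[symmetric] divide_right_mono)
    then show "exp (u x / \<epsilon>) \<le> exp (v x / \<epsilon>) * exp (\<delta> / \<epsilon>)"
      by (simp flip: exp_add)
  qed (use u v \<open>\<epsilon> > 0\<close> in \<open>auto intro!: integrable_continuous_compact[OF \<mu> Z] continuous_intros\<close>)
  then have "exp (log_int_exp \<epsilon> \<mu> u / \<epsilon>) \<le> exp (log_int_exp \<epsilon> \<mu> v / \<epsilon>) * exp (\<delta> / \<epsilon>)"
    using exp_log_int_exp[OF \<mu> Z u \<open>\<epsilon> > 0\<close>] exp_log_int_exp[OF \<mu> Z v \<open>\<epsilon> > 0\<close>] by simp
  then have "log_int_exp \<epsilon> \<mu> u / \<epsilon> \<le> log_int_exp \<epsilon> \<mu> v / \<epsilon> + \<delta> / \<epsilon>"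
    by (simp flip: exp_add)
  then show ?thesis
    using \<open>\<epsilon> > 0\<close> by (simp add: add_divide_distrib[symmetric] divide_le_cancel)
qed

lemma log_int_exp_nonexpansive:
  fixes u v :: "'a::topological_space \<Rightarrow> real"
  assumes "\<mu> \<in> borel_probs Z" "compact Z" "continuous_on Z u" "continuous_on Z v" "\<epsilon> > 0"
    and "\<And>x. x \<in> Z \<Longrightarrow> \<bar>u x - v x\<bar> \<le> \<delta>"
  shows "\<bar>log_int_exp \<epsilon> \<mu> u - log_int_exp \<epsilon> \<mu> v\<bar> \<le> \<delta>"
  using log_int_exp_mono[of \<mu> Z u v \<epsilon> \<delta>] log_int_exp_mono[of \<mu> Z v u \<epsilon> \<delta>] assms
  by (fastforce simp: abs_le_iff)

text \<open>Compare \<open>u\<close> with the zero function, whose soft maximum is 0 because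
  \<open>\<mu>\<close> is a probability measure.\<close>

lemma log_int_exp_bound:
  fixes u :: "'a::topological_space \<Rightarrow> real"
  assumes "\<mu> \<in> borel_probs Z" "compact Z" "continuous_on Z u" "\<epsilon> > 0"
    and "\<And>x. x \<in> Z \<Longrightarrow> \<bar>u x\<bar> \<le> B"
  shows "\<bar>log_int_exp \<epsilon> \<mu> u\<bar> \<le> B"
proof -
  have "log_int_exp \<epsilon> \<mu> (\<lambda>_. 0) = 0"
    using prob_space.prob_space[OF borel_probsD(1)[OF assms(1)]] by (simp add: log_int_exp_def)
  then show ?thesis
    using log_int_exp_nonexpansive[OF assms(1-3), of "\<lambda>_. 0" \<epsilon> B] assms(4,5) by simp
qed

text \<open>The potential \<open>u\<close> cancels when the integrands at \<open>x\<close> and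
  \<open>x'\<close> are compared, so \<open>d\<close> comes from the uniform continuity of
  \<open>c\<close> alone. Therefore \<open>u\<close> is quantified after \<open>d\<close>: no
  control of the potentials is needed for equicontinuity of their transforms.\<close>

lemma log_int_exp_equicontinuous:
  fixes c :: "'a::metric_space \<times> 'b::metric_space \<Rightarrow> real"
  assumes N: "N \<in> borel_probs Y" and "compact X" and Y: "compact Y"
    and c: "continuous_on (X \<times> Y) c" and "\<epsilon> > 0" and "e > 0"
  shows "\<exists>d>0. \<forall>u. continuous_on Y u \<longrightarrow> (\<forall>x\<in>X. \<forall>x'\<in>X. dist x x' < d \<longrightarrow>
    \<bar>log_int_exp \<epsilon> N (\<lambda>y. u y - c (x, y)) - log_int_exp \<epsilon> N (\<lambda>y. u y - c (x', y))\<bar> \<le> e)"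
proof -
  have "uniformly_continuous_on (X \<times> Y) c"
    using assms by (intro compact_uniformly_continuous compact_Times)
  then obtain d where "d > 0" and d: "\<And>z z'. z \<in> X \<times> Y \<Longrightarrow> z' \<in> X \<times> Y \<Longrightarrow> dist z' z < d \<Longrightarrow>
      dist (c z') (c z) < e"
    using \<open>e > 0\<close> unfolding uniformly_continuous_on_def by metis
  have cont: "continuous_on Y (\<lambda>y. c (x, y))" if "x \<in> X" for x
    using that by (intro continuous_on_compose2[OF c] continuous_intros) auto
  show ?thesis
  proof (intro exI[of _ d] conjI allI impI ballI)
    fix u :: "'b \<Rightarrow> real" and x x' assume *: "continuous_on Y u" "x \<in> X" "x' \<in> X" "dist x x' < d"
    have "\<bar>c (x, y) - c (x', y)\<bar> < e" if "y \<in> Y" for y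
      using d[of "(x', y)" "(x, y)"] * that by (simp add: dist_Pair_Pair dist_real_def)
    then show "\<bar>log_int_exp \<epsilon> N (\<lambda>y. u y - c (x, y)) - log_int_exp \<epsilon> N (\<lambda>y. u y - c (x', y))\<bar> \<le> e"
      using * \<open>\<epsilon> > 0\<close> by (intro log_int_exp_nonexpansive[OF N Y] continuous_intros cont)
        (auto simp: abs_minus_commute less_imp_le)
  qed (fact \<open>d > 0\<close>)
qed

lemma continuous_on_log_int_exp:
  fixes c :: "'a::metric_space \<times> 'b::metric_space \<Rightarrow> real"
  assumes "N \<in> borel_probs Y" "compact X" "compact Y"
    and "continuous_on (X \<times> Y) c" "\<epsilon> > 0" and u: "continuous_on Y u"
  shows "continuous_on X (\<lambda>x. log_int_exp \<epsilon> N (\<lambda>y. u y - c (x, y)))"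
proof (rule continuous_onI)
  fix x and e :: real assume "x \<in> X" "e > 0"
  obtain d where "d > 0" "\<And>x'. x' \<in> X \<Longrightarrow> dist x' x < d \<Longrightarrow>
      \<bar>log_int_exp \<epsilon> N (\<lambda>y. u y - c (x', y)) - log_int_exp \<epsilon> N (\<lambda>y. u y - c (x, y))\<bar> \<le> e"
    using log_int_exp_equicontinuous[OF assms(1-5) \<open>e > 0\<close>] u \<open>x \<in> X\<close> by metis
  then show "\<exists>d>0. \<forall>x'\<in>X. dist x' x < d \<longrightarrow>
      dist (log_int_exp \<epsilon> N (\<lambda>y. u y - c (x', y))) (log_int_exp \<epsilon> N (\<lambda>y. u y - c (x, y))) \<le> e"
    unfolding dist_real_def by blast
qed

section \<open>The Gibbs kernel and its partial integrals\<close>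

lemma continuous_on_gibbs_kernel:
  fixes c :: "'a::metric_space \<times> 'b::metric_space \<Rightarrow> real"
  assumes "continuous_on (X \<times> Y) c" "continuous_on X \<phi>" "continuous_on Y \<psi>" "\<epsilon> > 0"
  shows "continuous_on (X \<times> Y) (\<lambda>(x, y). exp ((\<phi> x + \<psi> y - c (x, y)) / \<epsilon>))"
proof -
  have "continuous_on (X \<times> Y) (\<lambda>z. \<phi> (fst z))" "continuous_on (X \<times> Y) (\<lambda>z. \<psi> (snd z))"
    by (auto intro!: continuous_on_compose2[OF assms(2)] continuous_on_compose2[OF assms(3)]
        continuous_intros)
  then show ?thesis
    unfolding case_prod_beta using assms by (auto intro!: continuous_intros)
qed

text \<open>By Fubini, integrating out one variable leaves the potential in the other variable plus
  a soft maximum inside the exponential. The first form serves the optimisation over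
  \<open>\<phi>\<close>, the second that over \<open>\<psi>\<close>.\<close>

lemma
  fixes c :: "'a::metric_space \<times> 'b::metric_space \<Rightarrow> real"
  assumes M: "M \<in> borel_probs X" and N: "N \<in> borel_probs Y"
    and X: "compact X" and Y: "compact Y" and c: "continuous_on (X \<times> Y) c" and "\<epsilon> > 0"
    and \<phi>: "continuous_on X \<phi>" and \<psi>: "continuous_on Y \<psi>"
  shows integral_gibbs_kernel_fst:
      "(\<integral>(x, y). exp ((\<phi> x + \<psi> y - c (x, y)) / \<epsilon>) \<partial>(M \<Otimes>\<^sub>M N))
        = (\<integral>x. exp ((\<phi> x + log_int_exp \<epsilon> N (\<lambda>y. \<psi> y - c (x, y))) / \<epsilon>) \<partial>M)" (is ?fst)
    and integral_gibbs_kernel_snd: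
      "(\<integral>(x, y). exp ((\<phi> x + \<psi> y - c (x, y)) / \<epsilon>) \<partial>(M \<Otimes>\<^sub>M N))
        = (\<integral>y. exp ((\<psi> y + log_int_exp \<epsilon> M (\<lambda>x. \<phi> x - c (x, y))) / \<epsilon>) \<partial>N)" (is ?snd)
proof -
  interpret M: prob_space M by (rule borel_probsD[OF M])
  interpret N: prob_space N by (rule borel_probsD[OF N])
  interpret pair_prob_space M N ..
  have exp_split: "exp ((a + b) / \<epsilon>) = exp (a / \<epsilon>) * exp (b / \<epsilon>)"
    and exp_split1: "exp ((a + b - d) / \<epsilon>) = exp (a / \<epsilon>) * exp ((b - d) / \<epsilon>)"
    and exp_split2: "exp ((a + b - d) / \<epsilon>) = exp (b / \<epsilon>) * exp ((a - d) / \<epsilon>)" for a b d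
    by (simp_all add: add_divide_distrib diff_divide_distrib exp_add exp_diff)
  have int: "integrable (M \<Otimes>\<^sub>M N) (\<lambda>(x, y). exp ((\<phi> x + \<psi> y - c (x, y)) / \<epsilon>))"
    using assms by (intro integrable_pair_continuous[OF M N] continuous_on_gibbs_kernel)
  have "(\<integral>y. exp ((\<phi> x + \<psi> y - c (x, y)) / \<epsilon>) \<partial>N)
      = exp ((\<phi> x + log_int_exp \<epsilon> N (\<lambda>y. \<psi> y - c (x, y))) / \<epsilon>)" if "x \<in> space M" for x
  proof -
    have "continuous_on Y (\<lambda>y. c (x, y))"
      using that borel_probsD(3)[OF M]
      by (intro continuous_on_compose2[OF c] continuous_intros) auto
    then have "exp (\<phi> x / \<epsilon>) * exp (log_int_exp \<epsilon> N (\<lambda>y. \<psi> y - c (x, y)) / \<epsilon>)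
        = (\<integral>y. exp (\<phi> x / \<epsilon>) * exp ((\<psi> y - c (x, y)) / \<epsilon>) \<partial>N)"
      using \<psi> \<open>\<epsilon> > 0\<close> by (subst exp_log_int_exp[OF N Y]) (auto intro!: continuous_intros)
    then show ?thesis
      by (simp only: exp_split1 exp_split)
  qed
  then show ?fst
    unfolding integral_fst[OF int, symmetric] by (rule Bochner_Integration.integral_cong[OF refl])
  have "(\<integral>x. exp ((\<phi> x + \<psi> y - c (x, y)) / \<epsilon>) \<partial>M)
      = exp ((\<psi> y + log_int_exp \<epsilon> M (\<lambda>x. \<phi> x - c (x, y))) / \<epsilon>)" if "y \<in> space N" for y
  proof -
    have "continuous_on X (\<lambda>x. c (x, y))"
      using that borel_probsD(3)[OF N]
      by (intro continuous_on_compose2[OF c] continuous_intros) auto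
    then have "exp (\<psi> y / \<epsilon>) * exp (log_int_exp \<epsilon> M (\<lambda>x. \<phi> x - c (x, y)) / \<epsilon>)
        = (\<integral>x. exp (\<psi> y / \<epsilon>) * exp ((\<phi> x - c (x, y)) / \<epsilon>) \<partial>M)"
      using \<phi> \<open>\<epsilon> > 0\<close> by (subst exp_log_int_exp[OF M X]) (auto intro!: continuous_intros)
    then show ?thesis
      by (simp only: exp_split2 exp_split)
  qed
  then show ?snd
    unfolding integral_snd[OF int, symmetric] by (rule Bochner_Integration.integral_cong[OF refl])
qed

section \<open>The dual problem and its optimal responses\<close>

locale entropic_dual =
  fixes p :: nat and \<epsilon> :: real
    and X :: "nat \<Rightarrow> 'a::metric_space set" and Y :: "'b::metric_space set"
    and \<nu> :: "nat \<Rightarrow> 'a measure" and \<eta> :: "'b measure"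
    and c :: "nat \<Rightarrow> 'a \<times> 'b \<Rightarrow> real" and l :: "nat \<Rightarrow> real"
  assumes \<epsilon>_pos: "\<epsilon> > 0"
    and compact_X: "\<And>i. i \<in> {1..p} \<Longrightarrow> compact (X i)" and compact_Y: "compact Y"
    and \<nu>: "\<And>i. i \<in> {1..p} \<Longrightarrow> \<nu> i \<in> borel_probs (X i)" and \<eta>: "\<eta> \<in> borel_probs Y"
    and cont_c: "\<And>i. i \<in> {1..p} \<Longrightarrow> continuous_on (X i \<times> Y) (c i)"
    and l_pos: "\<And>i. i \<in> {1..p} \<Longrightarrow> l i > 0" and sum_l: "(\<Sum>i=1..p. l i) = 1"
begin

abbreviation ADM where "ADM \<equiv> admissible p X Y l"
abbreviation J where "J \<equiv> dual_J p \<epsilon> l \<nu> \<eta> c"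

text \<open>Up to sign, the entropic c-transform of \<open>\<phi> i\<close>.\<close>

definition softmax :: "(nat \<Rightarrow> 'a \<Rightarrow> real) \<Rightarrow> nat \<Rightarrow> 'b \<Rightarrow> real" where
  "softmax \<phi> i y = log_int_exp \<epsilon> (\<nu> i) (\<lambda>x. \<phi> i x - c i (x, y))"

text \<open>The Lagrange condition for the constraint makes
  \<open>\<psi> i y + softmax \<phi> i y\<close> equal for all \<open>i\<close>; averaging with the
  weights \<open>l\<close> identifies the common value as the mean of the soft maxima.\<close>

definition best_psi :: "(nat \<Rightarrow> 'a \<Rightarrow> real) \<Rightarrow> nat \<Rightarrow> 'b \<Rightarrow> real" where
  "best_psi \<phi> i y = (\<Sum>j=1..p. l j * softmax \<phi> j y) - softmax \<phi> i y"

text \<open>The entropic c-transform of \<open>\<psi> i\<close>, which solves the Schroedinger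
  equation: with it the Gibbs kernel has \<open>\<eta>\<close>-integral 1 for each
  \<open>x\<close>.\<close>

definition best_phi :: "(nat \<Rightarrow> 'b \<Rightarrow> real) \<Rightarrow> nat \<Rightarrow> 'a \<Rightarrow> real" where
  "best_phi \<psi> i x = - log_int_exp \<epsilon> \<eta> (\<lambda>y. \<psi> i y - c i (x, y))"

definition base_point :: 'b where
  "base_point = (SOME y. y \<in> Y)"

text \<open>Vanishing at one point turns a bound on the oscillation into a bound on the absolute
  value. The subtracted constants have weighted sum zero, so the constraint is preserved.\<close>

definition normalised_psi :: "(nat \<Rightarrow> 'a \<Rightarrow> real) \<Rightarrow> nat \<Rightarrow> 'b \<Rightarrow> real" where
  "normalised_psi \<phi> i y = best_psi \<phi> i y - best_psi \<phi> i base_point"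

lemma base_point_in: "base_point \<in> Y"
proof -
  have "Y \<noteq> {}"
    using prob_space.not_empty[OF borel_probsD(1)[OF \<eta>]] borel_probsD(3)[OF \<eta>] by simp
  then show ?thesis
    unfolding base_point_def by (simp add: some_in_eq)
qed

lemma admissibleD:
  assumes "(\<phi>, \<psi>) \<in> ADM"
  shows "\<And>i. i \<in> {1..p} \<Longrightarrow> continuous_on (X i) (\<phi> i)"
    and "\<And>i. i \<in> {1..p} \<Longrightarrow> continuous_on Y (\<psi> i)"
    and "\<And>y. y \<in> Y \<Longrightarrow> (\<Sum>i=1..p. l i * \<psi> i y) = 0"
  using assms by (auto simp: admissible_def)

lemma cont_c_fst: "i \<in> {1..p} \<Longrightarrow> y \<in> Y \<Longrightarrow> continuous_on (X i) (\<lambda>x. c i (x, y))"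
  by (intro continuous_on_compose2[OF cont_c] continuous_intros) auto

lemma cont_c_snd: "i \<in> {1..p} \<Longrightarrow> x \<in> X i \<Longrightarrow> continuous_on Y (\<lambda>y. c i (x, y))"
  by (intro continuous_on_compose2[OF cont_c] continuous_intros) auto

lemma cont_c_swap: "i \<in> {1..p} \<Longrightarrow> continuous_on (Y \<times> X i) (\<lambda>z. c i (snd z, fst z))"
  by (intro continuous_on_compose2[OF cont_c] continuous_intros) auto

lemma c_bounded:
  obtains C where "\<And>i x y. i \<in> {1..p} \<Longrightarrow> x \<in> X i \<Longrightarrow> y \<in> Y \<Longrightarrow> \<bar>c i (x, y)\<bar> \<le> C"
proof -
  have "\<forall>i\<in>{1..p}. \<exists>B. \<forall>z\<in>X i \<times> Y. \<bar>c i z\<bar> \<le> B"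
  proof
    fix i assume i: "i \<in> {1..p}"
    show "\<exists>B. \<forall>z\<in>X i \<times> Y. \<bar>c i z\<bar> \<le> B"
      by (rule continuous_on_compact_bdd[OF compact_Times[OF compact_X[OF i] compact_Y] cont_c[OF i]])
        blast
  qed
  from bchoice[OF this] obtain B where B: "\<And>i z. i \<in> {1..p} \<Longrightarrow> z \<in> X i \<times> Y \<Longrightarrow> \<bar>c i z\<bar> \<le> B i"
    by blast
  show thesis
  proof
    fix i x y assume *: "i \<in> {1..p}" "x \<in> X i" "y \<in> Y"
    \<comment> \<open>Absolute values make all summands nonnegative, so that the finite sum
      dominates each of them and is a bound common to all \<open>i\<close>.\<close>
    have "\<bar>c i (x, y)\<bar> \<le> \<bar>B i\<bar>"
      using B[of i "(x, y)"] * by auto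
    also have "\<dots> \<le> (\<Sum>i=1..p. \<bar>B i\<bar>)"
      using * by (intro member_le_sum) auto
    finally show "\<bar>c i (x, y)\<bar> \<le> (\<Sum>i=1..p. \<bar>B i\<bar>)" .
  qed
qed

lemma continuous_on_softmax:
  assumes "i \<in> {1..p}" "continuous_on (X i) (\<phi> i)"
  shows "continuous_on Y (softmax \<phi> i)"
  using continuous_on_log_int_exp[OF \<nu>[OF assms(1)] compact_Y compact_X[OF assms(1)]
      cont_c_swap[OF assms(1)] \<epsilon>_pos assms(2)]
  by (simp add: softmax_def[abs_def])

lemma continuous_on_best_psi:
  assumes "\<And>i. i \<in> {1..p} \<Longrightarrow> continuous_on (X i) (\<phi> i)" "i \<in> {1..p}"
  shows "continuous_on Y (best_psi \<phi> i)"
  unfolding best_psi_def[abs_def] using assms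
  by (intro continuous_intros continuous_on_softmax) auto

lemma continuous_on_best_phi:
  assumes "i \<in> {1..p}" "continuous_on Y (\<psi> i)"
  shows "continuous_on (X i) (best_phi \<psi> i)"
  unfolding best_phi_def[abs_def] using assms
  by (intro continuous_intros continuous_on_log_int_exp[OF \<eta> compact_X compact_Y cont_c \<epsilon>_pos])

lemma sum_best_psi: "(\<Sum>i=1..p. l i * best_psi \<phi> i y) = 0"
proof -
  have "(\<Sum>i=1..p. l i * best_psi \<phi> i y)
      = (\<Sum>i=1..p. l i) * (\<Sum>j=1..p. l j * softmax \<phi> j y) - (\<Sum>i=1..p. l i * softmax \<phi> i y)"
    unfolding best_psi_def right_diff_distrib sum_subtractf sum_distrib_right ..
  then show ?thesis
    using sum_l by simp
qed

section \<open>Admissibility and increase of the dual functional under optimal responses\<close>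

lemma best_psi_admissible:
  assumes adm: "(\<phi>, \<psi>) \<in> ADM"
  shows "(\<phi>, best_psi \<phi>) \<in> ADM"
  unfolding admissible_def
  using admissibleD(1)[OF adm] continuous_on_best_psi[of \<phi>, OF admissibleD(1)[OF adm]] sum_best_psi[of \<phi>]
  by blast

lemma best_phi_admissible:
  assumes adm: "(\<phi>, \<psi>) \<in> ADM"
  shows "(best_phi \<psi>, \<psi>) \<in> ADM"
  unfolding admissible_def
  using admissibleD(2,3)[OF adm] continuous_on_best_phi[of _ \<psi>] by blast

lemma shift_admissible:
  assumes "(\<phi>, \<psi>) \<in> ADM" "(\<Sum>i=1..p. l i * a i) = 0"
  shows "(\<lambda>i x. \<phi> i x + a i, \<lambda>i y. \<psi> i y - a i) \<in> ADM"
  using assms by (auto simp: admissible_def right_diff_distrib sum_subtractf intro!: continuous_intros)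

text \<open>The sums \<open>\<phi> i x + \<psi> i y\<close>, hence the exponential terms, do not
  change. Each linear term gains \<open>l i * a i\<close>, as \<open>\<nu> i\<close> has mass one,
  and these gains cancel.\<close>

lemma dual_J_shift:
  assumes "(\<phi>, \<psi>) \<in> ADM" and a: "(\<Sum>i=1..p. l i * a i) = 0"
  shows "J (\<lambda>i x. \<phi> i x + a i, \<lambda>i y. \<psi> i y - a i) = J (\<phi>, \<psi>)"
proof -
  have "(\<integral>x. \<phi> i x + a i \<partial>\<nu> i) = (\<integral>x. \<phi> i x \<partial>\<nu> i) + a i" if i: "i \<in> {1..p}" for i
  proof -
    interpret prob_space "\<nu> i" by (rule borel_probsD[OF \<nu>[OF i]])
    show ?thesis
      using integrable_continuous_compact[OF \<nu>[OF i] compact_X[OF i] admissibleD(1)[OF assms(1) i]]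
      by (simp add: prob_space)
  qed
  then have "J (\<lambda>i x. \<phi> i x + a i, \<lambda>i y. \<psi> i y - a i) = J (\<phi>, \<psi>) + (\<Sum>i=1..p. l i * a i)"
    by (simp add: dual_J_def algebra_simps sum.distrib[symmetric])
  then show ?thesis
    using a by simp
qed

text \<open>For fixed \<open>x\<close>, the map \<open>t \<mapsto> t - \<epsilon> exp ((t - best_phi \<psi> i x) / \<epsilon>)\<close> is maximal
  at \<open>t = best_phi \<psi> i x\<close>.\<close>

lemma dual_J_best_phi:
  assumes adm: "(\<phi>, \<psi>) \<in> ADM"
  shows "J (\<phi>, \<psi>) \<le> J (best_phi \<psi>, \<psi>)"
  unfolding dual_J_def prod.case
proof (intro sum_mono mult_left_mono)
  fix i assume i: "i \<in> {1..p}"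
  interpret prob_space "\<nu> i" by (rule borel_probsD[OF \<nu>[OF i]])
  let ?g = "best_phi \<psi>"
  let ?H = "\<lambda>f. (\<integral>x. f x \<partial>\<nu> i)
       - \<epsilon> * (\<integral>(x, y). exp ((f x + \<psi> i y - c i (x, y)) / \<epsilon>) \<partial>(\<nu> i \<Otimes>\<^sub>M \<eta>))"
  have g: "continuous_on (X i) (?g i)"
    by (intro continuous_on_best_phi i admissibleD(2)[OF adm])
  have \<phi>: "continuous_on (X i) (\<phi> i)"
    by (rule admissibleD(1)[OF adm i])
  have int: "integrable (\<nu> i) f" if "continuous_on (X i) f" for f :: "'a \<Rightarrow> real"
    by (rule integrable_continuous_compact[OF \<nu>[OF i] compact_X[OF i] that])
  have exp_int: "integrable (\<nu> i) (\<lambda>x. exp ((f x - ?g i x) / \<epsilon>))"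
    if "continuous_on (X i) f" for f
    using that g \<epsilon>_pos by (intro int continuous_intros) auto
  \<comment> \<open>Integrating out \<open>y\<close> leaves a single integral over
    \<open>X i\<close>, so the optimisation can be done separately at each \<open>x\<close>.\<close>
  have H: "?H f = (\<integral>x. f x - \<epsilon> * exp ((f x - ?g i x) / \<epsilon>) \<partial>\<nu> i)"
    if f: "continuous_on (X i) f" for f
    using integral_gibbs_kernel_fst[OF \<nu>[OF i] \<eta> compact_X[OF i] compact_Y cont_c[OF i] \<epsilon>_pos f
        admissibleD(2)[OF adm i]] int[OF f] exp_int[OF f]
    by (simp add: best_phi_def)
  have "\<phi> i x - \<epsilon> * exp ((\<phi> i x - ?g i x) / \<epsilon>) \<le> ?g i x - \<epsilon> * exp ((?g i x - ?g i x) / \<epsilon>)" for x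
  proof -
    have "\<epsilon> * (1 + (\<phi> i x - ?g i x) / \<epsilon>) \<le> \<epsilon> * exp ((\<phi> i x - ?g i x) / \<epsilon>)"
      using \<epsilon>_pos by (intro mult_left_mono exp_ge_add_one_self) auto
    moreover have "\<epsilon> * (1 + (\<phi> i x - ?g i x) / \<epsilon>) = \<epsilon> + (\<phi> i x - ?g i x)"
      using \<epsilon>_pos by (simp add: field_simps)
    ultimately show ?thesis by simp
  qed
  then show "?H (\<phi> i) \<le> ?H (?g i)"
    unfolding H[OF \<phi>] H[OF g]
    by (intro integral_mono Bochner_Integration.integrable_diff integrable_mult_right int exp_int \<phi> g)
qed (use l_pos in \<open>auto intro: less_imp_le\<close>)

text \<open>With \<open>x\<close> integrated out, \<open>\<psi>\<close> enters only through one
  integral over \<open>Y\<close>, and the constraint is pointwise too; for fixed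
  \<open>\<phi>\<close> the problem can thus be solved at each \<open>y\<close> separately.\<close>

lemma dual_J_alt:
  assumes adm: "(\<phi>, \<psi>) \<in> ADM"
  shows "J (\<phi>, \<psi>) = (\<Sum>i=1..p. l i * (\<integral>x. \<phi> i x \<partial>\<nu> i))
    - \<epsilon> * (\<integral>y. (\<Sum>i=1..p. l i * exp ((\<psi> i y + softmax \<phi> i y) / \<epsilon>)) \<partial>\<eta>)"
    and "integrable \<eta> (\<lambda>y. \<Sum>i=1..p. l i * exp ((\<psi> i y + softmax \<phi> i y) / \<epsilon>))"
proof -
  have int: "integrable \<eta> (\<lambda>y. l i * exp ((\<psi> i y + softmax \<phi> i y) / \<epsilon>))" if i: "i \<in> {1..p}" for i
    using admissibleD[OF adm] continuous_on_softmax[OF i] i \<epsilon>_pos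
    by (intro integrable_continuous_compact[OF \<eta> compact_Y] continuous_intros) auto
  then show "integrable \<eta> (\<lambda>y. \<Sum>i=1..p. l i * exp ((\<psi> i y + softmax \<phi> i y) / \<epsilon>))"
    by (intro Bochner_Integration.integrable_sum)
  have "(\<integral>(x, y). exp ((\<phi> i x + \<psi> i y - c i (x, y)) / \<epsilon>) \<partial>(\<nu> i \<Otimes>\<^sub>M \<eta>))
      = (\<integral>y. exp ((\<psi> i y + softmax \<phi> i y) / \<epsilon>) \<partial>\<eta>)" if i: "i \<in> {1..p}" for i
    using integral_gibbs_kernel_snd[OF \<nu>[OF i] \<eta> compact_X[OF i] compact_Y cont_c[OF i] \<epsilon>_pos
        admissibleD(1,2)[OF adm i]] by (simp add: softmax_def)
  then show "J (\<phi>, \<psi>) = (\<Sum>i=1..p. l i * (\<integral>x. \<phi> i x \<partial>\<nu> i))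
    - \<epsilon> * (\<integral>y. (\<Sum>i=1..p. l i * exp ((\<psi> i y + softmax \<phi> i y) / \<epsilon>)) \<partial>\<eta>)"
    using int by (simp add: dual_J_def Bochner_Integration.integral_sum right_diff_distrib
        sum_subtractf sum_distrib_left mult_ac)
qed

text \<open>\<open>best_psi \<phi>\<close> makes \<open>\<psi>\<^sub>i + softmax \<phi> i\<close> independent of \<open>i\<close>; by convexity of \<open>exp\<close> this minimises
  the weighted sum of exponentials under the constraint \<open>\<Sum> l\<^sub>i \<psi>\<^sub>i = 0\<close>.\<close>

lemma dual_J_best_psi:
  assumes adm: "(\<phi>, \<psi>) \<in> ADM"
  shows "J (\<phi>, \<psi>) \<le> J (\<phi>, best_psi \<phi>)"
proof -
  have "(\<Sum>i=1..p. l i * exp ((best_psi \<phi> i y + softmax \<phi> i y) / \<epsilon>))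
      \<le> (\<Sum>i=1..p. l i * exp ((\<psi> i y + softmax \<phi> i y) / \<epsilon>))" if y: "y \<in> Y" for y
  proof -
    define m where "m = (\<Sum>j=1..p. l j * softmax \<phi> j y)"
    define s where "s i = \<psi> i y + softmax \<phi> i y" for i
    have "(\<Sum>i=1..p. l i * s i) = m"
      using admissibleD(3)[OF adm y] by (simp add: s_def m_def distrib_left sum.distrib)
    \<comment> \<open>The tangent of the exponential at the mean \<open>m\<close> will be used as a
      lower bound: its linear part averages to zero, since \<open>m\<close> is the weighted mean of
      the \<open>s i\<close>.\<close>
    then have "(\<Sum>i=1..p. l i * (1 + (s i - m) / \<epsilon>)) = 1"
      using sum_l by (simp add: distrib_left right_diff_distrib diff_divide_distrib sum.distrib
          sum_subtractf flip: sum_divide_distrib sum_distrib_right)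
    then have "exp (m / \<epsilon>) = exp (m / \<epsilon>) * (\<Sum>i=1..p. l i * (1 + (s i - m) / \<epsilon>))"
      by (simp only: mult_1_right)
    also have "\<dots> = (\<Sum>i=1..p. l i * (exp (m / \<epsilon>) * (1 + (s i - m) / \<epsilon>)))"
      by (simp only: sum_distrib_left mult.left_commute)
    also have "\<dots> \<le> (\<Sum>i=1..p. l i * (exp (m / \<epsilon>) * exp ((s i - m) / \<epsilon>)))"
      using l_pos by (intro sum_mono mult_left_mono exp_ge_add_one_self) (auto intro: less_imp_le)
    also have "\<dots> = (\<Sum>i=1..p. l i * exp (s i / \<epsilon>))"
      by (simp add: diff_divide_distrib flip: exp_add)
    finally show ?thesis
      using sum_l by (simp add: best_psi_def s_def m_def flip: sum_distrib_right)
  qed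
  then have "(\<integral>y. (\<Sum>i=1..p. l i * exp ((best_psi \<phi> i y + softmax \<phi> i y) / \<epsilon>)) \<partial>\<eta>)
      \<le> (\<integral>y. (\<Sum>i=1..p. l i * exp ((\<psi> i y + softmax \<phi> i y) / \<epsilon>)) \<partial>\<eta>)"
    using dual_J_alt(2)[OF adm] dual_J_alt(2)[OF best_psi_admissible[OF adm]]
    by (intro integral_mono) (auto simp: borel_probsD(3)[OF \<eta>])
  then show ?thesis
    using \<epsilon>_pos by (simp add: dual_J_alt(1)[OF adm] dual_J_alt(1)[OF best_psi_admissible[OF adm]])
qed

text \<open>Respond optimally to \<open>\<phi>\<close>, shift by constants, then respond optimally
  to the shifted \<open>\<psi>\<close>. The outer steps do not decrease the value and the shift
  preserves it. As \<open>best_phi\<close> sees only the new \<open>\<psi>\<close>, the shifted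
  \<open>\<phi>\<close> is needed only as an intermediate comparison.\<close>

lemma improvement:
  assumes adm: "(\<phi>, \<psi>) \<in> ADM"
  shows "(best_phi (normalised_psi \<phi>), normalised_psi \<phi>) \<in> ADM"
    and "J (\<phi>, \<psi>) \<le> J (best_phi (normalised_psi \<phi>), normalised_psi \<phi>)"
proof -
  define a where "a i = best_psi \<phi> i base_point" for i
  have a: "(\<Sum>i=1..p. l i * a i) = 0"
    unfolding a_def by (rule sum_best_psi)
  have eq: "normalised_psi \<phi> = (\<lambda>i y. best_psi \<phi> i y - a i)"
    by (simp add: normalised_psi_def a_def fun_eq_iff)
  have shift: "(\<lambda>i x. \<phi> i x + a i, normalised_psi \<phi>) \<in> ADM"
    unfolding eq by (rule shift_admissible[OF best_psi_admissible[OF adm] a])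
  then show "(best_phi (normalised_psi \<phi>), normalised_psi \<phi>) \<in> ADM"
    by (rule best_phi_admissible)
  have "J (\<phi>, \<psi>) \<le> J (\<phi>, best_psi \<phi>)"
    by (rule dual_J_best_psi[OF adm])
  also have "\<dots> = J (\<lambda>i x. \<phi> i x + a i, normalised_psi \<phi>)"
    unfolding eq by (rule dual_J_shift[OF best_psi_admissible[OF adm] a, symmetric])
  also have "\<dots> \<le> J (best_phi (normalised_psi \<phi>), normalised_psi \<phi>)"
    by (rule dual_J_best_phi[OF shift])
  finally show "J (\<phi>, \<psi>) \<le> J (best_phi (normalised_psi \<phi>), normalised_psi \<phi>)" .
qed

section \<open>Bounds and equicontinuity that depend on the costs alone\<close>

text \<open>One \<open>\<delta>\<close> comes from the convex combination of the soft maxima, the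
  other from the subtracted soft maximum of index \<open>i\<close>.\<close>

lemma best_psi_diff:
  assumes "i \<in> {1..p}" and diff: "\<And>j. j \<in> {1..p} \<Longrightarrow> \<bar>softmax \<phi> j y - softmax \<phi> j y'\<bar> \<le> \<delta>"
  shows "\<bar>best_psi \<phi> i y - best_psi \<phi> i y'\<bar> \<le> 2 * \<delta>"
proof -
  have "\<bar>\<Sum>j=1..p. l j * (softmax \<phi> j y - softmax \<phi> j y')\<bar> \<le> (\<Sum>j=1..p. l j * \<delta>)"
  proof (intro sum_abs[THEN order_trans] sum_mono)
    fix j assume "j \<in> {1..p}"
    then show "\<bar>l j * (softmax \<phi> j y - softmax \<phi> j y')\<bar> \<le> l j * \<delta>"
      unfolding abs_mult using l_pos[of j] diff[of j] by (simp add: mult_left_mono)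
  qed
  also have "\<dots> = \<delta>"
    using sum_l by (simp flip: sum_distrib_right)
  finally show ?thesis
    using diff[OF assms(1)] by (simp add: best_psi_def right_diff_distrib sum_subtractf)
qed

text \<open>The bound \<open>B\<close> is fixed before the potentials. With \<open>C\<close>
  bounding the costs, soft maxima oscillate by at most \<open>2 * C\<close>, so
  \<open>best_psi\<close> oscillates by at most \<open>4 * C\<close>; subtracting the cost gives
  \<open>5 * C\<close> for \<open>best_phi\<close>.\<close>

lemma improvement_bounded:
  obtains B where "\<And>\<phi> \<psi> i y. (\<phi>, \<psi>) \<in> ADM \<Longrightarrow> i \<in> {1..p} \<Longrightarrow> y \<in> Y \<Longrightarrow> \<bar>normalised_psi \<phi> i y\<bar> \<le> B"
    and "\<And>\<phi> \<psi> i x. (\<phi>, \<psi>) \<in> ADM \<Longrightarrow> i \<in> {1..p} \<Longrightarrow> x \<in> X i \<Longrightarrow>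
      \<bar>best_phi (normalised_psi \<phi>) i x\<bar> \<le> B"
proof -
  obtain C where C: "\<And>i x y. i \<in> {1..p} \<Longrightarrow> x \<in> X i \<Longrightarrow> y \<in> Y \<Longrightarrow> \<bar>c i (x, y)\<bar> \<le> C"
    using c_bounded by blast
  have \<psi>_bd: "\<bar>normalised_psi \<phi> i y\<bar> \<le> 4 * C"
    if adm: "(\<phi>, \<psi>) \<in> ADM" and i: "i \<in> {1..p}" and y: "y \<in> Y" for \<phi> \<psi> i y
  proof -
    have "\<bar>softmax \<phi> j y - softmax \<phi> j base_point\<bar> \<le> 2 * C" if j: "j \<in> {1..p}" for j
      unfolding softmax_def
    proof (rule log_int_exp_nonexpansive[OF \<nu>[OF j] compact_X[OF j] _ _ \<epsilon>_pos])
      fix x assume "x \<in> X j"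
      then show "\<bar>\<phi> j x - c j (x, y) - (\<phi> j x - c j (x, base_point))\<bar> \<le> 2 * C"
        using C[OF j _ y] C[OF j _ base_point_in] by fastforce
    qed (use j y base_point_in admissibleD(1)[OF adm j] in \<open>auto intro!: continuous_intros cont_c_fst\<close>)
    then show ?thesis
      using best_psi_diff[OF i, of \<phi> y base_point "2 * C"] by (simp add: normalised_psi_def)
  qed
  have \<phi>_bd: "\<bar>best_phi (normalised_psi \<phi>) i x\<bar> \<le> 5 * C"
    if adm: "(\<phi>, \<psi>) \<in> ADM" and i: "i \<in> {1..p}" and x: "x \<in> X i" for \<phi> \<psi> i x
    unfolding best_phi_def abs_minus_cancel
  proof (rule log_int_exp_bound[OF \<eta> compact_Y _ \<epsilon>_pos])
    show "continuous_on Y (\<lambda>y. normalised_psi \<phi> i y - c i (x, y))"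
      using admissibleD(2)[OF improvement(1)[OF adm] i] cont_c_snd[OF i x]
      by (intro continuous_intros)
    show "\<bar>normalised_psi \<phi> i y - c i (x, y)\<bar> \<le> 5 * C" if "y \<in> Y" for y
      using \<psi>_bd[OF adm i that] C[OF i x that] by linarith
  qed
  show thesis
  \<comment> \<open>The absolute value covers both bounds without first showing that
    \<open>C\<close> is nonnegative.\<close>
  proof (rule that[of "5 * \<bar>C\<bar>"])
    show "\<bar>normalised_psi \<phi> i y\<bar> \<le> 5 * \<bar>C\<bar>"
      if "(\<phi>, \<psi>) \<in> ADM" "i \<in> {1..p}" "y \<in> Y" for \<phi> \<psi> i y
      using \<psi>_bd[OF that] by linarith
    show "\<bar>best_phi (normalised_psi \<phi>) i x\<bar> \<le> 5 * \<bar>C\<bar>"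
      if "(\<phi>, \<psi>) \<in> ADM" "i \<in> {1..p}" "x \<in> X i" for \<phi> \<psi> i x
      using \<phi>_bd[OF that] by linarith
  qed
qed

text \<open>Each soft maximum inherits a modulus of continuity from its cost. Normalisation cancels
  in differences, and \<open>best_psi_diff\<close> doubles the error, which is why the soft maxima
  are controlled to \<open>e / 2\<close>.\<close>

lemma normalised_psi_equicontinuous:
  assumes "e > 0"
  shows "\<exists>d>0. \<forall>\<phi> \<psi>. (\<phi>, \<psi>) \<in> ADM \<longrightarrow> (\<forall>i\<in>{1..p}. \<forall>y\<in>Y. \<forall>y'\<in>Y. dist y y' < d \<longrightarrow>
    \<bar>normalised_psi \<phi> i y - normalised_psi \<phi> i y'\<bar> \<le> e)"
proof -
  have "\<exists>d>0. \<forall>u. continuous_on (X j) u \<longrightarrow> (\<forall>y\<in>Y. \<forall>y'\<in>Y. dist y y' < d \<longrightarrow>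
      \<bar>log_int_exp \<epsilon> (\<nu> j) (\<lambda>x. u x - c j (x, y)) - log_int_exp \<epsilon> (\<nu> j) (\<lambda>x. u x - c j (x, y'))\<bar>
        \<le> e / 2)" if j: "j \<in> {1..p}" for j
    using log_int_exp_equicontinuous[OF \<nu>[OF j] compact_Y compact_X[OF j] cont_c_swap[OF j] \<epsilon>_pos,
        of "e / 2"] \<open>e > 0\<close> by simp
  then have "\<forall>j\<in>{1..p}. \<exists>d>0. \<forall>u. continuous_on (X j) u \<longrightarrow> (\<forall>y\<in>Y. \<forall>y'\<in>Y. dist y y' < d \<longrightarrow>
      \<bar>log_int_exp \<epsilon> (\<nu> j) (\<lambda>x. u x - c j (x, y)) - log_int_exp \<epsilon> (\<nu> j) (\<lambda>x. u x - c j (x, y'))\<bar>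
        \<le> e / 2)"
    by blast
  from bchoice[OF this] obtain D where D: "\<And>j. j \<in> {1..p} \<Longrightarrow> D j > 0"
    "\<And>j u y y'. j \<in> {1..p} \<Longrightarrow> continuous_on (X j) u \<Longrightarrow> y \<in> Y \<Longrightarrow> y' \<in> Y \<Longrightarrow> dist y y' < D j \<Longrightarrow>
      \<bar>log_int_exp \<epsilon> (\<nu> j) (\<lambda>x. u x - c j (x, y)) - log_int_exp \<epsilon> (\<nu> j) (\<lambda>x. u x - c j (x, y'))\<bar>
        \<le> e / 2"
    by blast
  \<comment> \<open>One radius for all the soft maxima, since \<open>best_psi\<close> mixes every
    index. The inserted 1 makes the set visibly nonempty.\<close>
  define d where "d = Min (insert 1 (D ` {1..p}))"
  show ?thesis
  proof (intro exI[of _ d] conjI allI impI ballI)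
    show "d > 0"
      using D(1) by (auto simp: d_def)
    fix \<phi> \<psi> i y y' assume adm: "(\<phi>, \<psi>) \<in> ADM" and i: "i \<in> {1..p}" and y: "y \<in> Y" "y' \<in> Y" "dist y y' < d"
    have "\<bar>softmax \<phi> j y - softmax \<phi> j y'\<bar> \<le> e / 2" if j: "j \<in> {1..p}" for j
    proof -
      have "d \<le> D j"
        unfolding d_def using j by (intro Min_le) auto
      then show ?thesis
        unfolding softmax_def using D(2)[OF j admissibleD(1)[OF adm j]] y by simp
    qed
    then show "\<bar>normalised_psi \<phi> i y - normalised_psi \<phi> i y'\<bar> \<le> e"
      using best_psi_diff[OF i, of \<phi> y y' "e / 2"] by (simp add: normalised_psi_def)
  qed
qed

section \<open>Compactness of improved sequences and passage to the limit\<close>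

text \<open>Bounds and moduli are uniform over all admissible pairs, so Arzela-Ascoli applies along
  any subsequence. This gives the extraction step required by
  \<open>finite_common_subseq\<close>.\<close>

lemma improvement_subseq:
  assumes adm: "\<And>n::nat. (\<Phi> n, \<Psi> n) \<in> ADM"
  obtains r where "strict_mono r"
    and "\<And>i. i \<in> {1..p} \<Longrightarrow> uniformly_convergent_on (X i) (\<lambda>k. best_phi (normalised_psi (\<Phi> (r k))) i)"
    and "\<And>i. i \<in> {1..p} \<Longrightarrow> uniformly_convergent_on Y (\<lambda>k. normalised_psi (\<Phi> (r k)) i)"
proof -
  obtain B where B: "\<And>\<phi> \<psi> i y. (\<phi>, \<psi>) \<in> ADM \<Longrightarrow> i \<in> {1..p} \<Longrightarrow> y \<in> Y \<Longrightarrow> \<bar>normalised_psi \<phi> i y\<bar> \<le> B"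
    "\<And>\<phi> \<psi> i x. (\<phi>, \<psi>) \<in> ADM \<Longrightarrow> i \<in> {1..p} \<Longrightarrow> x \<in> X i \<Longrightarrow> \<bar>best_phi (normalised_psi \<phi>) i x\<bar> \<le> B"
    using improvement_bounded by blast
  let ?P = "\<lambda>i r. uniformly_convergent_on (X i) (\<lambda>k. best_phi (normalised_psi (\<Phi> (r k))) i)
    \<and> uniformly_convergent_on Y (\<lambda>k. normalised_psi (\<Phi> (r k)) i)"
  have "\<exists>r. strict_mono r \<and> (\<forall>i\<in>{1..p}. ?P i r)"
  proof (rule finite_common_subseq)
    fix i and r :: "nat \<Rightarrow> nat" assume i: "i \<in> {1..p}" and "strict_mono r"
    obtain k1 where k1: "strict_mono k1" "uniformly_convergent_on Y (\<lambda>n. normalised_psi (\<Phi> (r (k1 n))) i)"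
    proof (rule Arzela_Ascoli_metric[OF compact_Y, of "\<lambda>n. normalised_psi (\<Phi> (r n)) i" B])
      show "\<bar>normalised_psi (\<Phi> (r n)) i y\<bar> \<le> B" if "y \<in> Y" for n y
        using B(1)[OF adm i that] .
      show "\<exists>d>0. \<forall>n. \<forall>y\<in>Y. \<forall>y'\<in>Y. dist y y' < d \<longrightarrow>
          \<bar>normalised_psi (\<Phi> (r n)) i y - normalised_psi (\<Phi> (r n)) i y'\<bar> \<le> e" if "e > 0" for e
        using normalised_psi_equicontinuous[OF that] adm i by metis
    qed blast
    \<comment> \<open>The second extraction refines the first, along which the \<open>\<psi>\<close>
      component already converges.\<close>
    obtain k2 where k2: "strict_mono k2"
      "uniformly_convergent_on (X i) (\<lambda>n. best_phi (normalised_psi (\<Phi> (r (k1 (k2 n))))) i)"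
    proof (rule Arzela_Ascoli_metric[OF compact_X[OF i], of "\<lambda>n. best_phi (normalised_psi (\<Phi> (r (k1 n)))) i" B])
      show "\<bar>best_phi (normalised_psi (\<Phi> (r (k1 n)))) i x\<bar> \<le> B" if "x \<in> X i" for n x
        using B(2)[OF adm i that] .
      show "\<exists>d>0. \<forall>n. \<forall>x\<in>X i. \<forall>x'\<in>X i. dist x x' < d \<longrightarrow>
          \<bar>best_phi (normalised_psi (\<Phi> (r (k1 n)))) i x - best_phi (normalised_psi (\<Phi> (r (k1 n)))) i x'\<bar>
            \<le> e" if e: "e > 0" for e
      proof -
        obtain d where "d > 0" and d: "\<And>u x x'. continuous_on Y u \<Longrightarrow> x \<in> X i \<Longrightarrow> x' \<in> X i \<Longrightarrow> dist x x' < d \<Longrightarrow>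
          \<bar>log_int_exp \<epsilon> \<eta> (\<lambda>y. u y - c i (x, y)) - log_int_exp \<epsilon> \<eta> (\<lambda>y. u y - c i (x', y))\<bar> \<le> e"
          using log_int_exp_equicontinuous[OF \<eta> compact_X[OF i] compact_Y cont_c[OF i] \<epsilon>_pos e] by metis
        have "continuous_on Y (normalised_psi (\<Phi> n) i)" for n
          by (rule admissibleD(2)[OF improvement(1)[OF adm] i])
        from d[OF this] have "\<bar>best_phi (normalised_psi (\<Phi> n)) i x - best_phi (normalised_psi (\<Phi> n)) i x'\<bar> \<le> e"
          if "x \<in> X i" "x' \<in> X i" "dist x x' < d" for n x x'
          unfolding best_phi_def minus_diff_minus abs_minus_cancel using that by blast
        with \<open>d > 0\<close> show ?thesis
          by blast
      qed
    qed blast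
    show "\<exists>k. strict_mono k \<and> ?P i (r \<circ> k)"
      using k2 uniformly_convergent_on_subseq[OF k1(2) k2(1)] strict_mono_o[OF k1(1) k2(1)]
      by (intro exI[of _ "k1 \<circ> k2"]) simp
  next
    fix i r and k :: "nat \<Rightarrow> nat" assume P: "?P i r" and k: "strict_mono k"
    show "?P i (r \<circ> k)"
      using uniformly_convergent_on_subseq[OF P[THEN conjunct1] k]
        uniformly_convergent_on_subseq[OF P[THEN conjunct2] k] by simp
  qed simp
  then obtain r where r: "strict_mono r" "\<And>i. i \<in> {1..p} \<Longrightarrow> ?P i r"
    by blast
  show thesis
    by (rule that[OF r(1) r(2)[THEN conjunct1] r(2)[THEN conjunct2]])
qed

text \<open>Uniform limits keep continuity and the linear constraint, so the limit pair is
  admissible. The common bound \<open>B\<close> supplies constant dominating functions for both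
  kinds of integrals.\<close>

lemma dual_J_uniform_limit:
  assumes adm: "\<And>n::nat. (\<Phi> n, \<Psi> n) \<in> ADM"
    and \<Phi>_bd: "\<And>n i x. i \<in> {1..p} \<Longrightarrow> x \<in> X i \<Longrightarrow> \<bar>\<Phi> n i x\<bar> \<le> B"
    and \<Psi>_bd: "\<And>n i y. i \<in> {1..p} \<Longrightarrow> y \<in> Y \<Longrightarrow> \<bar>\<Psi> n i y\<bar> \<le> B"
    and \<Phi>_conv: "\<And>i. i \<in> {1..p} \<Longrightarrow> uniformly_convergent_on (X i) (\<lambda>n. \<Phi> n i)"
    and \<Psi>_conv: "\<And>i. i \<in> {1..p} \<Longrightarrow> uniformly_convergent_on Y (\<lambda>n. \<Psi> n i)"
  obtains q where "q \<in> ADM" "(\<lambda>n. J (\<Phi> n, \<Psi> n)) \<longlonglongrightarrow> J q"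
proof -
  obtain \<phi> where \<phi>: "\<And>i. i \<in> {1..p} \<Longrightarrow> uniform_limit (X i) (\<lambda>n. \<Phi> n i) (\<phi> i) sequentially"
    using \<Phi>_conv unfolding uniformly_convergent_on_def by metis
  obtain \<psi> where \<psi>: "\<And>i. i \<in> {1..p} \<Longrightarrow> uniform_limit Y (\<lambda>n. \<Psi> n i) (\<psi> i) sequentially"
    using \<Psi>_conv unfolding uniformly_convergent_on_def by metis
  have \<phi>_lim: "(\<lambda>n. \<Phi> n i x) \<longlonglongrightarrow> \<phi> i x" if "i \<in> {1..p}" "x \<in> X i" for i x
    using tendsto_uniform_limitI[OF \<phi>] that by blast
  have \<psi>_lim: "(\<lambda>n. \<Psi> n i y) \<longlonglongrightarrow> \<psi> i y" if "i \<in> {1..p}" "y \<in> Y" for i y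
    using tendsto_uniform_limitI[OF \<psi>] that by blast
  have \<phi>_cont: "continuous_on (X i) (\<phi> i)" if "i \<in> {1..p}" for i
    using admissibleD(1)[OF adm that] by (intro uniform_limit_theorem[OF _ \<phi>[OF that]]) auto
  have \<psi>_cont: "continuous_on Y (\<psi> i)" if "i \<in> {1..p}" for i
    using admissibleD(2)[OF adm that] by (intro uniform_limit_theorem[OF _ \<psi>[OF that]]) auto
  have "(\<Sum>i=1..p. l i * \<psi> i y) = 0" if y: "y \<in> Y" for y
  proof -
    have "(\<lambda>n. \<Sum>i=1..p. l i * \<Psi> n i y) \<longlonglongrightarrow> (\<Sum>i=1..p. l i * \<psi> i y)"
      using \<psi>_lim y by (intro tendsto_intros) auto
    then show ?thesis
      using admissibleD(3)[OF adm y] by (simp add: LIMSEQ_const_iff)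
  qed
  then have lim_adm: "(\<phi>, \<psi>) \<in> ADM"
    using \<phi>_cont \<psi>_cont by (simp add: admissible_def)
  obtain C where C: "\<And>i x y. i \<in> {1..p} \<Longrightarrow> x \<in> X i \<Longrightarrow> y \<in> Y \<Longrightarrow> \<bar>c i (x, y)\<bar> \<le> C"
    using c_bounded by blast
  have int_\<phi>: "(\<lambda>n. \<integral>x. \<Phi> n i x \<partial>\<nu> i) \<longlonglongrightarrow> (\<integral>x. \<phi> i x \<partial>\<nu> i)" if i: "i \<in> {1..p}" for i
  proof -
    interpret prob_space "\<nu> i" by (rule borel_probsD[OF \<nu>[OF i]])
    note meas = borel_measurable_integrable[OF integrable_continuous_compact[OF \<nu>[OF i] compact_X[OF i]]]
    show ?thesis
      using \<phi>_lim[OF i] \<Phi>_bd[OF i] borel_probsD(3)[OF \<nu>[OF i]]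
        meas[OF \<phi>_cont[OF i]] meas[OF admissibleD(1)[OF adm i]]
      by (intro integral_dominated_convergence[where w = "\<lambda>_. B"]) auto
  qed
  have int_exp: "(\<lambda>n. \<integral>(x, y). exp ((\<Phi> n i x + \<Psi> n i y - c i (x, y)) / \<epsilon>) \<partial>(\<nu> i \<Otimes>\<^sub>M \<eta>))
      \<longlonglongrightarrow> (\<integral>(x, y). exp ((\<phi> i x + \<psi> i y - c i (x, y)) / \<epsilon>) \<partial>(\<nu> i \<Otimes>\<^sub>M \<eta>))" if i: "i \<in> {1..p}" for i
  proof -
    interpret M: prob_space "\<nu> i" by (rule borel_probsD[OF \<nu>[OF i]])
    interpret N: prob_space \<eta> by (rule borel_probsD[OF \<eta>])
    interpret pair_prob_space "\<nu> i" \<eta> ..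
    note meas = borel_measurable_pair_continuous[OF \<nu>[OF i] \<eta> compact_X[OF i] compact_Y
        continuous_on_gibbs_kernel[OF cont_c[OF i] _ _ \<epsilon>_pos]]
    have space: "space (\<nu> i \<Otimes>\<^sub>M \<eta>) = X i \<times> Y"
      using borel_probsD(3)[OF \<nu>[OF i]] borel_probsD(3)[OF \<eta>] by (simp add: space_pair_measure)
    show ?thesis
    \<comment> \<open>Each potential contributes at most \<open>B\<close> to the exponent and the
      negative cost at most \<open>C\<close>.\<close>
    proof (rule integral_dominated_convergence[where w = "\<lambda>_. exp ((2 * B + C) / \<epsilon>)"])
      show "AE z in \<nu> i \<Otimes>\<^sub>M \<eta>. (\<lambda>n. case z of (x, y) \<Rightarrow> exp ((\<Phi> n i x + \<Psi> n i y - c i (x, y)) / \<epsilon>))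
          \<longlonglongrightarrow> (case z of (x, y) \<Rightarrow> exp ((\<phi> i x + \<psi> i y - c i (x, y)) / \<epsilon>))"
        using \<phi>_lim[OF i] \<psi>_lim[OF i] \<epsilon>_pos
        by (intro AE_I2) (auto simp: space intro!: tendsto_intros)
      show "AE z in \<nu> i \<Otimes>\<^sub>M \<eta>. norm (case z of (x, y) \<Rightarrow> exp ((\<Phi> n i x + \<Psi> n i y - c i (x, y)) / \<epsilon>))
          \<le> exp ((2 * B + C) / \<epsilon>)" for n
      proof (intro AE_I2)
        fix z assume "z \<in> space (\<nu> i \<Otimes>\<^sub>M \<eta>)"
        then obtain x y where z: "z = (x, y)" "x \<in> X i" "y \<in> Y"
          by (auto simp: space)
        have "\<Phi> n i x + \<Psi> n i y - c i (x, y) \<le> 2 * B + C"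
          using \<Phi>_bd[OF i z(2), of n] \<Psi>_bd[OF i z(3), of n] C[OF i z(2,3)] by linarith
        then show "norm (case z of (x, y) \<Rightarrow> exp ((\<Phi> n i x + \<Psi> n i y - c i (x, y)) / \<epsilon>))
            \<le> exp ((2 * B + C) / \<epsilon>)"
          using \<epsilon>_pos by (simp add: z(1) divide_right_mono)
      qed
    qed (use i admissibleD(1,2)[OF adm] \<phi>_cont \<psi>_cont in \<open>auto intro!: meas\<close>)
  qed
  have "(\<lambda>n. J (\<Phi> n, \<Psi> n)) \<longlonglongrightarrow> J (\<phi>, \<psi>)"
    unfolding dual_J_def prod.case by (intro tendsto_intros int_\<phi> int_exp)
  with lim_adm show thesis
    by (rule that)
qed

section \<open>Existence of a maximiser and the compactness statement\<close>

text \<open>A maximising sequence exists in \<open>ereal\<close> before the supremum is known to be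
  finite. Its improved subsequence has values converging to the real number \<open>J q\<close>,
  which bounds the supremum from above and thereby proves finiteness too.\<close>

lemma dual_sup_attained: "\<exists>q\<in>ADM. ereal (J q) = dual_sup p \<epsilon> X Y l \<nu> \<eta> c"
proof -
  let ?S = "dual_sup p \<epsilon> X Y l \<nu> \<eta> c"
  \<comment> \<open>The zero pair makes the set of values nonempty, as needed to reach its supremum
    by a sequence of values.\<close>
  have "(\<lambda>_ _. 0, \<lambda>_ _. 0) \<in> ADM"
    by (simp add: admissible_def)
  then have "(\<lambda>q. ereal (J q)) ` ADM \<noteq> {}"
    by blast
  then obtain f where f: "incseq f" "range f \<subseteq> (\<lambda>q. ereal (J q)) ` ADM"
    "Sup ((\<lambda>q. ereal (J q)) ` ADM) = (SUP n::nat. f n)"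
    using Sup_countable_SUP by metis
  have "\<forall>n. \<exists>\<phi> \<psi>. (\<phi>, \<psi>) \<in> ADM \<and> f n = ereal (J (\<phi>, \<psi>))"
    using f(2) by fast
  then obtain \<Phi> \<Psi> where adm: "\<And>n. (\<Phi> n, \<Psi> n) \<in> ADM" and fJ: "\<And>n. f n = ereal (J (\<Phi> n, \<Psi> n))"
    by metis
  have S: "?S = (SUP n. f n)"
    using f(3) by (simp add: dual_sup_def)
  obtain r where r: "strict_mono r"
    "\<And>i. i \<in> {1..p} \<Longrightarrow> uniformly_convergent_on (X i) (\<lambda>k. best_phi (normalised_psi (\<Phi> (r k))) i)"
    "\<And>i. i \<in> {1..p} \<Longrightarrow> uniformly_convergent_on Y (\<lambda>k. normalised_psi (\<Phi> (r k)) i)"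
    using improvement_subseq[of \<Phi> \<Psi>, OF adm] by blast
  obtain B where B: "\<And>\<phi> \<psi> i y. (\<phi>, \<psi>) \<in> ADM \<Longrightarrow> i \<in> {1..p} \<Longrightarrow> y \<in> Y \<Longrightarrow> \<bar>normalised_psi \<phi> i y\<bar> \<le> B"
    "\<And>\<phi> \<psi> i x. (\<phi>, \<psi>) \<in> ADM \<Longrightarrow> i \<in> {1..p} \<Longrightarrow> x \<in> X i \<Longrightarrow> \<bar>best_phi (normalised_psi \<phi>) i x\<bar> \<le> B"
    using improvement_bounded by blast
  obtain q where q: "q \<in> ADM"
    "(\<lambda>k. J (best_phi (normalised_psi (\<Phi> (r k))), normalised_psi (\<Phi> (r k)))) \<longlonglongrightarrow> J q"
    using dual_J_uniform_limit[OF improvement(1)[OF adm] B(2)[OF adm] B(1)[OF adm] r(2,3)] .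
  \<comment> \<open>The original values still tend to the supremum along \<open>r\<close>, and the
    improved values lie above them; comparing the limits gives
    \<open>?S \<le> ereal (J q)\<close>.\<close>
  have "(\<lambda>k. f (r k)) \<longlonglongrightarrow> ?S"
    unfolding S using LIMSEQ_subseq_LIMSEQ[OF LIMSEQ_SUP[OF f(1)] r(1)] by (simp add: o_def)
  moreover have "(\<lambda>k. ereal (J (best_phi (normalised_psi (\<Phi> (r k))), normalised_psi (\<Phi> (r k)))))
      \<longlonglongrightarrow> ereal (J q)"
    using q(2) by simp
  ultimately have "?S \<le> ereal (J q)"
    by (rule LIMSEQ_le) (simp add: fJ improvement(2)[OF adm])
  moreover have "ereal (J q) \<le> ?S"
    unfolding dual_sup_def by (rule SUP_upper[OF q(1)])
  ultimately show ?thesis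
    using q(1) by (intro bexI[of _ q] antisym)
qed

end

theorem theorem5p3:
  fixes p :: nat and \<epsilon> :: real
    and X :: "nat \<Rightarrow> 'a::metric_space set" and Y :: "'b::metric_space set"
    and \<nu> :: "nat \<Rightarrow> 'a measure" and \<eta> :: "'b measure"
    and c :: "nat \<Rightarrow> 'a \<times> 'b \<Rightarrow> real" and l :: "nat \<Rightarrow> real"
  assumes "p \<ge> 2" and "\<epsilon> > 0"
    and "\<And>i. i \<in> {1..p} \<Longrightarrow> compact (X i)" and "compact Y"
    and "\<And>i. i \<in> {1..p} \<Longrightarrow> \<nu> i \<in> borel_probs (X i)" and "\<eta> \<in> borel_probs Y"
    and "\<And>i. i \<in> {1..p} \<Longrightarrow> continuous_on (X i \<times> Y) (c i)"
    and "\<And>i. i \<in> {1..p} \<Longrightarrow> l i > 0" and "(\<Sum>i=1..p. l i) = 1"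
    and "\<And>i. i \<in> {1..p} \<Longrightarrow> spt (\<nu> i) = X i" and "spt \<eta> = Y"
  shows "(\<exists>q \<in> admissible p X Y l.
            ereal (dual_J p \<epsilon> l \<nu> \<eta> c q) = dual_sup p \<epsilon> X Y l \<nu> \<eta> c)
    \<and> (\<forall>\<Phi> \<Psi>. (\<forall>n::nat. (\<Phi> n, \<Psi> n) \<in> admissible p X Y l)
          \<and> (\<lambda>n. ereal (dual_J p \<epsilon> l \<nu> \<eta> c (\<Phi> n, \<Psi> n)))
              \<longlonglongrightarrow> dual_sup p \<epsilon> X Y l \<nu> \<eta> c
        \<longrightarrow> (\<exists>\<Phi>' \<Psi>'. (\<forall>n::nat. (\<Phi>' n, \<Psi>' n) \<in> admissible p X Y l
                \<and> dual_J p \<epsilon> l \<nu> \<eta> c (\<Phi>' n, \<Psi>' n) \<ge> dual_J p \<epsilon> l \<nu> \<eta> c (\<Phi> n, \<Psi> n))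
              \<and> (\<exists>r::nat \<Rightarrow> nat. strict_mono r \<and> (\<forall>i\<in>{1..p}.
                    uniformly_convergent_on (X i) (\<lambda>k. \<Phi>' (r k) i)
                  \<and> uniformly_convergent_on Y (\<lambda>k. \<Psi>' (r k) i)))))"
proof -
  interpret entropic_dual p \<epsilon> X Y \<nu> \<eta> c l
    using assms by unfold_locales
  \<comment> \<open>The modified pair at \<open>n\<close> is the normalised optimal response to
    \<open>\<Phi> n\<close> together with the optimal response to that.\<close>
  have "\<exists>\<Phi>' \<Psi>'. (\<forall>n::nat. (\<Phi>' n, \<Psi>' n) \<in> ADM \<and> J (\<Phi>' n, \<Psi>' n) \<ge> J (\<Phi> n, \<Psi> n))
      \<and> (\<exists>r::nat \<Rightarrow> nat. strict_mono r \<and> (\<forall>i\<in>{1..p}.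
            uniformly_convergent_on (X i) (\<lambda>k. \<Phi>' (r k) i)
          \<and> uniformly_convergent_on Y (\<lambda>k. \<Psi>' (r k) i)))"
    if adm: "\<And>n. (\<Phi> n, \<Psi> n) \<in> ADM" for \<Phi> \<Psi>
  proof -
    obtain r where "strict_mono r"
      "\<And>i. i \<in> {1..p} \<Longrightarrow> uniformly_convergent_on (X i) (\<lambda>k. best_phi (normalised_psi (\<Phi> (r k))) i)"
      "\<And>i. i \<in> {1..p} \<Longrightarrow> uniformly_convergent_on Y (\<lambda>k. normalised_psi (\<Phi> (r k)) i)"
      using improvement_subseq[of \<Phi> \<Psi>, OF adm] by blast
    then show ?thesis
      using improvement[OF adm]
      by (intro exI[of _ "\<lambda>n. best_phi (normalised_psi (\<Phi> n))"] exI[of _ "\<lambda>n. normalised_psi (\<Phi> n)"]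
          conjI allI exI[of _ r] ballI)
  qed
  with dual_sup_attained show ?thesis
    by blast
qed

end
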